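(* Let $V(x) := D_{\varphi^*}(x,\bar{x})$ for $x \in \mathbb{R}^n$. Then: (1) For every $x_0 \in \mathbb{R}^n$, every stabilizing control $u(\cdot) \in \mathcal{U}_{x_0}$, with $x(\cdot)$ the trajectory of $\dot{x}(t) = u(t)$, $x(0) = x_0$, and for all $t \ge 0$, $$\int_0^t q(x(s),u(s))\,ds \ \ge\ V(x_0) - V(x(t)).$$ In particular, $J_\infty(x_0,u(\cdot)) \ge V(x_0)$. (2) For each $x_0 \in \mathbb{R}^n$, the closed-loop system $\dot{x}(t) = -\nabla f(\nabla\varphi^*(x(t)))$, $x(0) = x_0$, gives rise to an optimal stabilizing control $u(t) = -\nabla f(\nabla\varphi^*(x(t)))$; that is, this control belongs to $\mathcal{U}_{x_0}$, minimizes $J_\infty(x_0,\cdot)$ over $\mathcal{U}_{x_0}$, and satisfies $$J_\infty(x_0,u(\cdot)) = V(x_0) = D_{\varphi^*}(x_0,\bar{x}).$$ Moreover, $V$ is a global Lyapunov function for the closed-loop system $\dot{x}(t) = -\nabla f(\nabla\varphi^*(x(t)))$ relative to the equilibrium $\bar{x}$.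
   Context: $\langle\cdot,\cdot\rangle$ and $|\cdot|$ are the Euclidean inner product and norm on $\mathbb{R}^n$. Standing assumptions: $f:\mathbb{R}^n\to\mathbb{R}$ is $C^1$ and strictly convex, with unique global minimizer $\bar{y}$; $\varphi:\mathbb{R}^n\to\mathbb{R}$ is $C^2$ and strictly convex; both are of Legendre type, meaning here that $|\nabla f(x)|\to+\infty$ and $|\nabla\varphi(x)|\to+\infty$ as $|x|\to+\infty$. The Legendre--Fenchel conjugate of $g$ is $g^*(v) := \sup_{x\in\mathbb{R}^n}\{\langle v,x\rangle - g(x)\}$. The map $\nabla\varphi:\mathbb{R}^n\to\mathbb{R}^n$ is then bijective with inverse $\nabla\varphi^*$. Put $\bar{x} := \nabla\varphi(\bar{y})$. The Bregman divergence of $\varphi^*$ is $D_{\varphi^*}(x,x') := \varphi^*(x)-\varphi^*(x')-\langle\nabla\varphi^*(x'),x-x'\rangle$. It is assumed that for each fixed $x'\in\mathbb{R}^n$, $D_{\varphi^*}(x,x')\to+\infty$ as $|x|\to+\infty$. For $x_0\in\mathbb{R}^n$, the class $\mathcal{U}_{x_0}$ of stabilizing controls at $x_0$ consists of all locally essentially bounded maps $u:[0,\infty)\to\mathbb{R}^n$ such that the trajectory of $\dot{x}(t)=u(t)$, $x(0)=x_0$, is defined for all $t\ge0$ and $x(t)\to\bar{x}$ as $t\to\infty$. The cost is $J_\infty(x_0,u(\cdot)) := \int_0^\infty q(x(t),u(t))\,dt$, where $q(x,u) := f(\nabla\varphi^*(x)) + f^*(-u) + \langle u,\bar{y}\rangle$.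 A global Lyapunov function for an autonomous system on $\mathbb{R}^n$ relative to an equilibrium $\bar{x}$ is a continuous function $V:\mathbb{R}^n\to\mathbb{R}$ such that: $V(\bar{x})=0$ and $V(x)>0$ for $x\ne\bar{x}$; all sublevel sets $\{x: V(x)\le c\}$ are compact; and for each $\xi\neq\bar{x}$ there is a time $\sigma>0$ such that along the trajectory $x(\cdot)$ of the system with $x(0)=\xi$ one has $V(x(t))\le V(\xi)$ for all $t\in[0,\sigma]$ and $V(x(\sigma))<V(\xi)$. *)

theory Defs
  imports "HOL-Analysis.Analysis"
begin

definition grad :: "('a::real_inner \<Rightarrow> real) \<Rightarrow> 'a \<Rightarrow> 'a" where
  "grad g x = (THE D. GDERIV g x :> D)"

definition C1_fun :: "('a::euclidean_space \<Rightarrow> real) \<Rightarrow> bool" where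
  "C1_fun g \<longleftrightarrow> (\<forall>x. g differentiable (at x)) \<and> continuous_on UNIV (grad g)"

definition C2_fun :: "('a::euclidean_space \<Rightarrow> real) \<Rightarrow> bool" where
  "C2_fun g \<longleftrightarrow> C1_fun g \<and>
     (\<exists>H :: 'a \<Rightarrow> 'a \<Rightarrow>\<^sub>L 'a. (\<forall>x. (grad g has_derivative blinfun_apply (H x)) (at x)) \<and>
        continuous_on UNIV H)"

definition strictly_convex :: "('a::real_vector \<Rightarrow> real) \<Rightarrow> bool" where
  "strictly_convex g \<longleftrightarrow>
     (\<forall>x y t. x \<noteq> y \<longrightarrow> 0 < t \<longrightarrow> t < 1 \<longrightarrow>
        g ((1 - t) *\<^sub>R x + t *\<^sub>R y) < (1 - t) * g x + t * g y)"

definition legendre_type :: "('a::euclidean_space \<Rightarrow> real) \<Rightarrow> bool" where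
  "legendre_type g \<longleftrightarrow> filterlim (\<lambda>x. norm (grad g x)) at_top at_infinity"

(* Real-valued: a C1, strictly convex function whose gradient norm tends to infinity is
   superlinear, so the supremum is over a set that is bounded above for every v. *)
definition conjugate :: "('a::euclidean_space \<Rightarrow> real) \<Rightarrow> 'a \<Rightarrow> real" where
  "conjugate g v = (SUP x. v \<bullet> x - g x)"

definition bregman :: "('a::euclidean_space \<Rightarrow> real) \<Rightarrow> 'a \<Rightarrow> 'a \<Rightarrow> real" where
  "bregman g x x' = g x - g x' - grad g x' \<bullet> (x - x')"

(* The unique absolutely continuous (Caratheodory) solution on t >= 0 of x' = u(t), x(0) = x0.
   It exists for all t >= 0 whenever u is measurable and locally essentially bounded. *)
definition trajectory :: "'a::euclidean_space \<Rightarrow> (real \<Rightarrow> 'a) \<Rightarrow> real \<Rightarrow> 'a" where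
  "trajectory x0 u t = x0 + integral {0..t} u"

(* Controls are maps on [0,\<infinity>); the values of u on negative times are irrelevant. *)
definition locally_ess_bounded :: "(real \<Rightarrow> 'a::euclidean_space) \<Rightarrow> bool" where
  "locally_ess_bounded u \<longleftrightarrow>
     u \<in> borel_measurable (lebesgue_on {0..}) \<and>
     (\<forall>T\<ge>0. \<exists>C. AE t in lebesgue_on {0..T}. norm (u t) \<le> C)"

definition stabilizing_controls :: "'a::euclidean_space \<Rightarrow> 'a \<Rightarrow> (real \<Rightarrow> 'a) set" where
  "stabilizing_controls xbar x0 =
     {u. locally_ess_bounded u \<and> (trajectory x0 u \<longlongrightarrow> xbar) at_top}"

definition running_cost ::
  "('a::euclidean_space \<Rightarrow> real) \<Rightarrow> ('a \<Rightarrow> real) \<Rightarrow> 'a \<Rightarrow> 'a \<Rightarrow> 'a \<Rightarrow> real" where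
  "running_cost f \<phi> ybar x u = f (grad (conjugate \<phi>) x) + conjugate f (- u) + u \<bullet> ybar"

(* Lebesgue integral with values in the extended reals (positive part minus negative part),
   so that a divergent cost is infinite. *)
definition extended_integral :: "'b measure \<Rightarrow> ('b \<Rightarrow> real) \<Rightarrow> ereal" where
  "extended_integral M g =
     enn2ereal (\<integral>\<^sup>+ t. ennreal (g t) \<partial>M) - enn2ereal (\<integral>\<^sup>+ t. ennreal (- g t) \<partial>M)"

definition total_cost ::
  "('a::euclidean_space \<Rightarrow> real) \<Rightarrow> ('a \<Rightarrow> real) \<Rightarrow> 'a \<Rightarrow> 'a \<Rightarrow> (real \<Rightarrow> 'a) \<Rightarrow> ereal" where
  "total_cost f \<phi> ybar x0 u =
     extended_integral (lebesgue_on {0..})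
       (\<lambda>t. running_cost f \<phi> ybar (trajectory x0 u t) (u t))"

definition ode_solution :: "('a::euclidean_space \<Rightarrow> 'a) \<Rightarrow> 'a \<Rightarrow> (real \<Rightarrow> 'a) \<Rightarrow> bool" where
  "ode_solution F x0 x \<longleftrightarrow>
     x 0 = x0 \<and> (\<forall>t\<ge>0. (x has_vector_derivative F (x t)) (at t within {0..}))"

definition closed_loop_field ::
  "('a::euclidean_space \<Rightarrow> real) \<Rightarrow> ('a \<Rightarrow> real) \<Rightarrow> 'a \<Rightarrow> 'a" where
  "closed_loop_field f \<phi> x = - grad f (grad (conjugate \<phi>) x)"

(* F is only continuous in the application, so solutions from a given initial state need not
   be unique: a solution is required to exist and the decrease condition to hold along every
   solution, with the same time \<sigma>. *)
definition global_lyapunov ::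
  "('a::euclidean_space \<Rightarrow> 'a) \<Rightarrow> 'a \<Rightarrow> ('a \<Rightarrow> real) \<Rightarrow> bool" where
  "global_lyapunov F xbar V \<longleftrightarrow>
     F xbar = 0 \<and>
     continuous_on UNIV V \<and>
     V xbar = 0 \<and> (\<forall>x. x \<noteq> xbar \<longrightarrow> V x > 0) \<and>
     (\<forall>c. compact {x. V x \<le> c}) \<and>
     (\<forall>\<xi>. \<xi> \<noteq> xbar \<longrightarrow>
        (\<exists>x. ode_solution F \<xi> x) \<and>
        (\<exists>\<sigma>>0. \<forall>x. ode_solution F \<xi> x \<longrightarrow>
           (\<forall>t\<in>{0..\<sigma>}. V (x t) \<le> V \<xi>) \<and> V (x \<sigma>) < V \<xi>))"

end

theory Submission
  imports Defs "HOL-Complex_Analysis.Great_Picard"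
begin

text \<open>
  Let \<open>grad_inv\<close> be the inverse of \<open>grad \<phi>\<close>; it is the gradient of the conjugate of \<open>\<phi>\<close>, so \<open>V\<close> is
  convex with \<open>grad V x = grad_inv x - ybar\<close>.  The Fenchel--Young inequality for \<open>f\<close>, at the point
  \<open>grad_inv x\<close> and the covector \<open>- u\<close>, says that the running cost satisfies
  \<open>q x u \<ge> - \<langle>grad V x, u\<rangle>\<close>, with equality exactly when \<open>- u = grad f (grad_inv x)\<close>.  So \<open>V\<close> solves the
  Hamilton--Jacobi--Bellman equation, and the feedback is the minimizer in it.  Integrating along
  a trajectory gives the dissipation inequality (\<open>dissipation_inequality\<close>), which is an equality
  for the closed loop; as trajectories tend to \<open>xbar\<close>, where \<open>V\<close> vanishes, the cost is at least
  \<open>V x0\<close> in general (\<open>total_cost_ge\<close>) and equal to it for the feedback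
  (\<open>closed_loop_total_cost\<close>).

  Three points need more than this formal computation.
  That \<open>grad \<phi>\<close> and \<open>grad f\<close> are homeomorphisms, so that both conjugates are finite and
  continuously differentiable, is derived from the growth of the gradients by a vanishing
  quadratic perturbation and invariance of domain (\<open>surj_grad\<close>, \<open>continuous_grad_inv\<close>,
  \<open>gderiv_conjugate\<close>).
  For a merely measurable control the chain rule for \<open>V\<close> along the trajectory is replaced by the
  convexity of \<open>V\<close> on short time steps.
  The closed-loop field is only continuous, so solutions come from Peano's theorem
  (\<open>peano_integral_equation\<close>); they exist for all time because \<open>V\<close> does not increase
  along them and has compact sublevel sets (\<open>closed_loop_has_solution\<close>).  Every solution then
  converges to \<open>xbar\<close>, because the decay rate \<open>W\<close> of \<open>V\<close> is positive away from \<open>xbar\<close>.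
\<close>

section \<open>Gradients\<close>

lemma GDERIV_unique:
  assumes "GDERIV g x :> D" "GDERIV g x :> D'"
  shows "D = D'"
proof -
  have "(\<lambda>h. h \<bullet> D) = (\<lambda>h. h \<bullet> D')"
    using assms has_derivative_unique unfolding gderiv_def by blast
  then show ?thesis
    by (metis inner_commute vector_eq_rdot)
qed

lemma grad_eqI: "GDERIV g x :> D \<Longrightarrow> grad g x = D"
  unfolding grad_def using GDERIV_unique by blast

text \<open>The Riesz vector of the derivative is obtained as the adjoint applied to \<open>1\<close>, which is
  where finite dimension enters.\<close>
lemma differentiable_imp_GDERIV_grad:
  fixes g :: "'a::euclidean_space \<Rightarrow> real"
  assumes "g differentiable (at x)"
  shows "GDERIV g x :> grad g x"
proof -
  obtain g' where g': "(g has_derivative g') (at x)"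
    using assms by (auto simp: differentiable_def)
  have "linear g'"
    using g' has_derivative_linear by blast
  then have "g' = (\<lambda>h. h \<bullet> adjoint g' 1)"
    by (simp add: adjoint_works)
  with g' have "GDERIV g x :> adjoint g' 1"
    unfolding gderiv_def by simp
  then show ?thesis
    using grad_eqI by metis
qed

section \<open>Legendre functions and their conjugates\<close>

locale legendre_function =
  fixes g :: "'a::euclidean_space \<Rightarrow> real"
  assumes C1: "C1_fun g"
    and strict: "strictly_convex g"
    and legendre: "legendre_type g"
begin

lemma gderiv: "GDERIV g x :> grad g x"
  using C1 by (simp add: C1_fun_def differentiable_imp_GDERIV_grad)

lemma continuous_grad: "continuous_on UNIV (grad g)"
  using C1 by (simp add: C1_fun_def)

lemma continuous: "continuous_on S g"
  using gderiv unfolding gderiv_def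
  by (meson continuous_at_imp_continuous_on has_derivative_continuous)

text \<open>Along the segment from \<open>x\<close> to \<open>y\<close> convexity bounds the difference quotients at \<open>x\<close> by
  \<open>g y - g x\<close>, and they converge to the directional derivative.\<close>
lemma tangent_le: "g x + grad g x \<bullet> (y - x) \<le> g y"
proof (cases "x = y")
  case False
  have d: "((\<lambda>t. g (x + t *\<^sub>R (y - x))) has_real_derivative (y - x) \<bullet> grad g x) (at 0)"
  proof -
    have "(g has_derivative (\<lambda>h. h \<bullet> grad g x)) (at (x + 0 *\<^sub>R (y - x)))"
      using gderiv[of x] by (simp add: gderiv_def)
    moreover have "((\<lambda>t. x + t *\<^sub>R (y - x)) has_derivative (\<lambda>t. t *\<^sub>R (y - x))) (at 0)"
      by (auto intro!: derivative_eq_intros)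
    ultimately have "((\<lambda>t. g (x + t *\<^sub>R (y - x))) has_derivative (\<lambda>t. (t *\<^sub>R (y - x)) \<bullet> grad g x)) (at 0)"
      by (rule has_derivative_compose[rotated])
    then show ?thesis
      by (simp add: has_field_derivative_def mult_commute_abs)
  qed
  then have "((\<lambda>t. (g (x + t *\<^sub>R (y - x)) - g x) / t) \<longlongrightarrow> (y - x) \<bullet> grad g x) (at 0)"
    by (simp add: has_field_derivative_iff)
  then have lim: "((\<lambda>t. (g (x + t *\<^sub>R (y - x)) - g x) / t) \<longlongrightarrow> (y - x) \<bullet> grad g x) (at_right 0)"
    by (rule tendsto_within_subset) simp
  have "(g (x + t *\<^sub>R (y - x)) - g x) / t \<le> g y - g x" if "0 < t" "t < 1" for t
  proof -
    have "g ((1 - t) *\<^sub>R x + t *\<^sub>R y) < (1 - t) * g x + t * g y"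
      using strict False that unfolding strictly_convex_def by blast
    moreover have "(1 - t) *\<^sub>R x + t *\<^sub>R y = x + t *\<^sub>R (y - x)"
      by (simp add: algebra_simps)
    ultimately show ?thesis
      using that by (simp add: field_simps)
  qed
  then have "eventually (\<lambda>t. (g (x + t *\<^sub>R (y - x)) - g x) / t \<le> g y - g x) (at_right 0)"
    by (auto simp: eventually_at_right_field intro!: exI[of _ 1])
  with lim have "(y - x) \<bullet> grad g x \<le> g y - g x"
    by (rule tendsto_upperbound) simp
  then show ?thesis
    by (simp add: inner_commute)
qed simp

text \<open>Evaluated at the midpoint \<open>m\<close>, the tangent inequality bounds \<open>g m - g x\<close> below by half of
  \<open>grad g x \<bullet> (y - x)\<close>, while strict convexity keeps it below half of \<open>g y - g x\<close>.\<close>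
lemma tangent_less:
  assumes "x \<noteq> y"
  shows "g x + grad g x \<bullet> (y - x) < g y"
proof -
  define m where "m = (1/2) *\<^sub>R x + (1/2) *\<^sub>R y"
  have "g ((1 - 1/2) *\<^sub>R x + (1/2) *\<^sub>R y) < (1 - 1/2) * g x + (1/2) * g y"
    using strict assms unfolding strictly_convex_def
    by (metis half_gt_zero_iff less_numeral_extra(1) field_sum_of_halves less_add_same_cancel1)
  then have "g m < (g x + g y) / 2"
    by (simp add: m_def)
  moreover have "g x + grad g x \<bullet> (m - x) \<le> g m"
    by (rule tangent_le)
  moreover have "m - x = (1/2) *\<^sub>R (y - x)"
    by (simp add: m_def algebra_simps flip: scaleR_add_left)
  ultimately show ?thesis
    by simp
qed

lemma inj_grad: "inj (grad g)"
proof (rule injI, rule ccontr)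
  fix x y
  assume eq: "grad g x = grad g y" and "x \<noteq> y"
  then show False
    using tangent_less[of x y] tangent_less[of y x] by (simp add: inner_diff_right)
qed

text \<open>Solving \<open>grad g x = v\<close> means finding a critical point of \<open>g - \<langle>v, \<cdot>\<rangle>\<close>, but coercivity of that
  function is not known beforehand.  Adding \<open>e/2 * |x|\<^sup>2\<close> makes it coercive, since \<open>g\<close> lies above
  its tangent at \<open>0\<close>.  The bound on \<open>e * norm x\<close> is uniform in \<open>e\<close>; this is what allows \<open>e\<close> to
  tend to \<open>0\<close> below.\<close>
lemma tilted_perturbation_has_critical_point:
  assumes "e > 0"
  obtains x where "grad g x = v - e *\<^sub>R x" "e * norm x \<le> 2 * norm (grad g 0 - v)"
proof -
  define p where "p = grad g 0 - v"
  define R where "R = 2 * norm p / e"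
  define k where "k = (\<lambda>x. g x - v \<bullet> x + e / 2 * (x \<bullet> x))"
  have "R \<ge> 0"
    using assms by (simp add: R_def)
  have cont: "continuous_on (cball 0 R) k"
    unfolding k_def by (intro continuous_intros continuous)
  obtain x where x: "x \<in> cball 0 R" and xmin: "\<And>y. y \<in> cball 0 R \<Longrightarrow> k x \<le> k y"
    using continuous_attains_inf[OF compact_cball _ cont] \<open>R \<ge> 0\<close> by auto
  \<comment> \<open>outside the ball of radius \<open>R\<close> the quadratic term beats the slope \<open>p\<close> of the tangent at \<open>0\<close>\<close>
  have min: "k x \<le> k y" for y
  proof (cases "y \<in> cball 0 R")
    case False
    then have "norm p \<le> e / 2 * norm y"
      using assms by (simp add: R_def field_simps)
    then have "norm p * norm y \<le> e / 2 * norm y * norm y"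
      by (intro mult_right_mono) auto
    moreover have "- (norm p * norm y) \<le> p \<bullet> y"
      using Cauchy_Schwarz_ineq2[of p y] by linarith
    moreover have "g 0 + p \<bullet> y \<le> g y - v \<bullet> y"
      using tangent_le[of 0 y] by (simp add: p_def inner_diff_left)
    ultimately have "k 0 \<le> k y"
      by (simp add: k_def mult.assoc norm_eq_sqrt_inner)
    with xmin[of 0] \<open>R \<ge> 0\<close> show ?thesis
      by simp
  qed (simp add: xmin)
  have "(k has_derivative (\<lambda>h. h \<bullet> (grad g x - v + e *\<^sub>R x))) (at x)"
    unfolding k_def using gderiv[of x, unfolded gderiv_def]
    by (auto intro!: derivative_eq_intros simp: fun_eq_iff inner_add_right inner_diff_right
        inner_commute field_simps)
  then have "(\<lambda>h. h \<bullet> (grad g x - v + e *\<^sub>R x)) = (\<lambda>h. 0)"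
    by (rule differential_zero_maxmin[of _ UNIV, rotated 2]) (auto simp: min)
  then have "grad g x - v + e *\<^sub>R x = 0"
    by (metis inner_eq_zero_iff)
  moreover have "e * norm x \<le> 2 * norm p"
    using x assms by (simp add: R_def field_simps)
  ultimately show ?thesis
    using that[of x] by (simp add: p_def algebra_simps)
qed

text \<open>The critical points \<open>X n\<close> of the perturbed functions have bounded gradients.  Since the
  norm of the gradient tends to infinity, the points themselves stay in a ball, so the
  perturbation \<open>e n *\<^sub>R X n\<close> vanishes in the limit and any cluster point has gradient \<open>v\<close>.\<close>
lemma surj_grad: "surj (grad g)"
proof -
  have "\<exists>x. grad g x = v" for v
  proof -
  define e where "e = (\<lambda>n. inverse (real (Suc n)))"
  have e_pos: "e n > 0" for n
    by (simp add: e_def)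
  have "\<exists>x. grad g x = v - e n *\<^sub>R x \<and> e n * norm x \<le> 2 * norm (grad g 0 - v)" for n
    using tilted_perturbation_has_critical_point[OF e_pos] by metis
  then obtain X where X: "\<And>n. grad g (X n) = v - e n *\<^sub>R X n"
      and Xb: "\<And>n. e n * norm (X n) \<le> 2 * norm (grad g 0 - v)"
    by metis
  define C where "C = norm v + 2 * norm (grad g 0 - v)"
  have Gb: "norm (grad g (X n)) \<le> C" for n
  proof -
    have "norm (grad g (X n)) \<le> norm v + e n * norm (X n)"
      using norm_triangle_ineq4[of v "e n *\<^sub>R X n"] e_pos[of n] by (simp add: X)
    with Xb[of n] show ?thesis
      by (simp add: C_def)
  qed
  obtain B where B: "\<And>x. norm x \<ge> B \<Longrightarrow> norm (grad g x) > C"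
    using legendre unfolding legendre_type_def filterlim_at_top_dense eventually_at_infinity
    by blast
  have "norm (X n) \<le> B" for n
    using B[of "X n"] Gb[of n] by linarith
  then have XB: "X n \<in> cball 0 B" for n
    by simp
  obtain l r where r: "strict_mono r" and l: "(X \<circ> r) \<longlonglongrightarrow> l"
    using compact_cball[of 0 B] XB unfolding compact_def by metis
  have "(\<lambda>n. e (r n)) \<longlonglongrightarrow> 0"
    using LIMSEQ_subseq_LIMSEQ[OF LIMSEQ_inverse_real_of_nat r] by (simp add: e_def o_def)
  then have "(\<lambda>n. v - e (r n) *\<^sub>R (X \<circ> r) n) \<longlonglongrightarrow> v - 0 *\<^sub>R l"
    by (intro tendsto_intros l)
  moreover have "(\<lambda>n. grad g ((X \<circ> r) n)) \<longlonglongrightarrow> grad g l"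
    using continuous_on_tendsto_compose[OF continuous_grad l] by simp
  ultimately have "grad g l = v"
    using LIMSEQ_unique by (fastforce simp: X)
  then show ?thesis by blast
  qed
  then show ?thesis by (metis surjI)
qed

definition grad_inv :: "'a \<Rightarrow> 'a" where "grad_inv = inv (grad g)"

lemma grad_grad_inv [simp]: "grad g (grad_inv v) = v"
  by (simp add: grad_inv_def surj_f_inv_f surj_grad)

lemma grad_inv_grad [simp]: "grad_inv (grad g x) = x"
  by (simp add: grad_inv_def inj_grad)

text \<open>A continuous injection of a Euclidean space into itself is open, by invariance of domain.\<close>
lemma continuous_grad_inv: "continuous_on UNIV grad_inv"
proof -
  have "open (grad_inv -` B)" if "open B" for B
  proof -
    have "grad_inv -` B = grad g ` B"
      by (auto simp: image_iff) (metis grad_grad_inv)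
    then show ?thesis
      using invariance_of_domain[of B "grad g"] that continuous_grad inj_grad
      by (metis continuous_on_subset inj_on_subset subset_UNIV)
  qed
  then show ?thesis
    by (simp add: continuous_on_open_vimage)
qed

lemma tilt_le: "v \<bullet> x - g x \<le> v \<bullet> grad_inv v - g (grad_inv v)"
  using tangent_le[of "grad_inv v" x] by (simp add: inner_diff_right)

text \<open>The supremum defining the conjugate is attained at the point whose gradient is \<open>v\<close>; in
  particular the conjugate is finite everywhere.\<close>
lemma conjugate_eq: "conjugate g v = v \<bullet> grad_inv v - g (grad_inv v)"
  unfolding conjugate_def
  by (rule cSup_eq_maximum) (auto simp: tilt_le)

lemma conjugate_grad: "conjugate g (grad g x) = grad g x \<bullet> x - g x"
  by (simp add: conjugate_eq)

lemma fenchel_young: "v \<bullet> x \<le> g x + conjugate g v"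
  using tilt_le[of v x] by (simp add: conjugate_eq)

lemma fenchel_young_less:
  assumes "x \<noteq> grad_inv v"
  shows "v \<bullet> x < g x + conjugate g v"
  using tangent_less[of "grad_inv v" x] assms by (simp add: conjugate_eq inner_diff_right)

lemma conjugate_tangent_le: "conjugate g v + (w - v) \<bullet> grad_inv v \<le> conjugate g w"
  using fenchel_young[of w "grad_inv v"] by (simp add: conjugate_eq[of v] inner_diff_left)

text \<open>The subgradient inequalities at \<open>v\<close> and at \<open>w\<close> sandwich the error of the linear
  approximation between \<open>0\<close> and \<open>\<langle>grad_inv w - grad_inv v, w - v\<rangle>\<close>, which is small by continuity
  of \<open>grad_inv\<close>.\<close>
lemma gderiv_conjugate: "GDERIV (conjugate g) v :> grad_inv v"
proof -
  have bound: "norm (conjugate g w - conjugate g v - (w - v) \<bullet> grad_inv v)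
      \<le> norm (grad_inv w - grad_inv v) * norm (w - v)" for w
  proof -
    have "conjugate g w - conjugate g v - (w - v) \<bullet> grad_inv v \<ge> 0"
      using conjugate_tangent_le[of v w] by simp
    moreover have "conjugate g w - conjugate g v - (w - v) \<bullet> grad_inv v \<le> (grad_inv w - grad_inv v) \<bullet> (w - v)"
      using conjugate_tangent_le[of w v] by (simp add: inner_diff inner_commute)
    moreover have "(grad_inv w - grad_inv v) \<bullet> (w - v) \<le> norm (grad_inv w - grad_inv v) * norm (w - v)"
      by (rule norm_cauchy_schwarz)
    ultimately show ?thesis
      by simp
  qed
  show ?thesis
    unfolding gderiv_def has_derivative_at_alt
  proof (intro conjI allI impI)
    show "bounded_linear (\<lambda>h. h \<bullet> grad_inv v)"
      by (rule bounded_linear_inner_left)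
    fix e :: real assume "e > 0"
    then obtain d where "d > 0" and d: "\<And>w. norm (w - v) < d \<Longrightarrow> norm (grad_inv w - grad_inv v) < e"
      using continuous_grad_inv unfolding continuous_on_iff dist_norm by (metis UNIV_I)
    have "norm (conjugate g w - conjugate g v - (w - v) \<bullet> grad_inv v) \<le> e * norm (w - v)"
      if "norm (w - v) < d" for w
    proof -
      have "norm (grad_inv w - grad_inv v) * norm (w - v) \<le> e * norm (w - v)"
        using d[OF that] by (intro mult_right_mono) auto
      with bound[of w] show ?thesis by linarith
    qed
    with \<open>d > 0\<close> show "\<exists>d>0. \<forall>w. norm (w - v) < d \<longrightarrow>
        norm (conjugate g w - conjugate g v - (w - v) \<bullet> grad_inv v) \<le> e * norm (w - v)"
      by blast
  qed
qed

lemma grad_conjugate: "grad (conjugate g) = grad_inv"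
  by (rule ext) (rule grad_eqI[OF gderiv_conjugate])

lemma continuous_conjugate: "continuous_on S (conjugate g)"
  using gderiv_conjugate unfolding gderiv_def
  by (meson continuous_at_imp_continuous_on has_derivative_continuous)

end

section \<open>Peano existence for bounded continuous fields\<close>

text \<open>The functions \<open>Y n\<close> are Euler polygons of step \<open>h n\<close>: the field is frozen at the piecewise
  constant \<open>P n\<close>, which agrees with \<open>Y n\<close> at the grid points.  All \<open>Y n\<close> are \<open>M\<close>-Lipschitz, so
  a subsequence that converges at every rational time converges at every time, and
  dominated convergence passes the integral equation to the limit.  Working with pointwise
  limits gives a solution on the whole half-line at once, without gluing.\<close>
lemma peano_integral_equation:
  fixes F :: "'a::euclidean_space \<Rightarrow> 'a"
  assumes cont: "continuous_on UNIV F" and bound: "\<And>x. norm (F x) \<le> M"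
  obtains x where "continuous_on {0::real..} x"
    and "\<And>t. 0 \<le> t \<Longrightarrow> x t = x0 + integral {0..t} (\<lambda>s. F (x s))"
proof -
  have "M \<ge> 0"
    using bound[of 0] norm_ge_zero order_trans by blast
  define h where "h = (\<lambda>n. inverse (real (Suc n)))"
  have h_pos: "h n > 0" for n by (simp add: h_def)
  define E where "E = (\<lambda>n. rec_nat x0 (\<lambda>_ y. y + h n *\<^sub>R F y))"
  have E0: "E n 0 = x0" and ESuc: "E n (Suc k) = E n k + h n *\<^sub>R F (E n k)" for n k
    by (simp_all add: E_def)
  define P where "P = (\<lambda>n s. E n (nat \<lfloor>s / h n\<rfloor>))"
  define Y where "Y = (\<lambda>n t. x0 + integral {0..t} (\<lambda>s. F (P n s)))"
  have meas: "(\<lambda>s. F (P n s)) \<in> borel_measurable borel" for n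
  proof -
    have "(\<lambda>s. nat \<lfloor>s / h n\<rfloor>) \<in> measurable borel (count_space UNIV)"
      by measurable
    moreover have "(\<lambda>k. F (E n k)) \<in> measurable (count_space UNIV) borel"
      by simp
    ultimately show ?thesis
      unfolding P_def by (rule measurable_compose)
  qed
  have int: "(\<lambda>s. F (P n s)) integrable_on {a..b}" for n a b
  proof (rule measurable_bounded_by_integrable_imp_integrable)
    show "(\<lambda>s. F (P n s)) \<in> borel_measurable (lebesgue_on {a..b})"
      using meas by (intro measurable_restrict_space1 measurable_completion) simp
    show "(\<lambda>s. M) integrable_on {a..b}"
      by (rule integrable_const_ivl)
  qed (use bound in auto)
  have Ydiff: "Y n t = Y n s + integral {s..t} (\<lambda>s. F (P n s))" if "0 \<le> s" "s \<le> t" for n s t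
    using Henstock_Kurzweil_Integration.integral_combine[OF that int[of n 0 t]] by (simp add: Y_def)
  have Ylip: "norm (Y n t - Y n s) \<le> M * (t - s)" if "0 \<le> s" "s \<le> t" for n s t
  proof -
    have "norm (integral {s..t} (\<lambda>s. F (P n s))) \<le> integral {s..t} (\<lambda>s. M)"
      using bound by (intro integral_norm_bound_integral int integrable_const_ivl) auto
    with that Ydiff[OF that, of n] show ?thesis
      by (simp add: mult.commute)
  qed
  have Ygrid: "Y n (real k * h n) = E n k" for n k
  proof (induction k)
    case 0
    then show ?case by (simp add: Y_def E0)
  next
    case (Suc k)
    let ?a = "real k * h n" and ?b = "real (Suc k) * h n"
    have ab: "0 \<le> ?a" "?a \<le> ?b" and len: "?b - ?a = h n"
      using h_pos[of n] by (auto simp: algebra_simps)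
    have "F (P n s) = F (E n k)" if "s \<in> {?a..?b} - {?b}" for s
    proof -
      have "\<lfloor>s / h n\<rfloor> = int k"
        using that h_pos[of n] by (intro floor_unique) (auto simp: field_simps)
      then show ?thesis by (simp add: P_def)
    qed
    then have "integral {?a..?b} (\<lambda>s. F (P n s)) = integral {?a..?b} (\<lambda>s. F (E n k))"
      by (intro integral_spike[of "{?b}"]) auto
    also have "\<dots> = h n *\<^sub>R F (E n k)"
      using ab len by simp
    finally show ?case
      using Ydiff[OF ab, of n] Suc by (simp add: ESuc)
  qed
  have YP: "norm (Y n s - P n s) \<le> M * h n" if "0 \<le> s" for n s
  proof -
    define k where "k = nat \<lfloor>s / h n\<rfloor>"
    have "real k \<le> s / h n" "s / h n < real k + 1"
      using that h_pos[of n] by (auto simp: k_def)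
    then have 1: "real k * h n \<le> s" and 2: "s - real k * h n \<le> h n"
      using h_pos[of n] by (auto simp: field_simps)
    have "norm (Y n s - Y n (real k * h n)) \<le> M * (s - real k * h n)"
      using 1 h_pos[of n] by (intro Ylip) auto
    also have "\<dots> \<le> M * h n"
      using 2 \<open>M \<ge> 0\<close> by (intro mult_left_mono)
    finally show ?thesis
      by (simp add: Ygrid P_def k_def)
  qed
  \<comment> \<open>The bound \<open>norm (Y n q - x0) \<le> M * q\<close> grows with \<open>q\<close>; dividing by \<open>1 + q\<close> makes it uniform, as
    the diagonal extraction requires.\<close>
  obtain r where r: "strict_mono r"
    and conv: "\<And>q. q \<in> \<rat> \<inter> {0..} \<Longrightarrow> \<exists>l. (\<lambda>n. (Y (r n) q - x0) /\<^sub>R (1 + q)) \<longlonglongrightarrow> l"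
  proof (rule function_convergent_subsequence[of "\<rat> \<inter> {0..}" "\<lambda>n q. (Y n q - x0) /\<^sub>R (1 + q)" M])
    show "countable (\<rat> \<inter> {0::real..})"
      using countable_rat by blast
    fix n and q :: real assume "q \<in> \<rat> \<inter> {0..}"
    then have "q \<ge> 0" by simp
    then have "norm (Y n q - x0) \<le> M * q"
      using Ylip[of 0 q n] by (simp add: Y_def)
    also have "\<dots> \<le> M * (1 + q)"
      using \<open>M \<ge> 0\<close> by (simp add: algebra_simps)
    finally have "norm (Y n q - x0) / (1 + q) \<le> M"
      using \<open>q \<ge> 0\<close> by (simp add: pos_divide_le_eq)
    then show "norm ((Y n q - x0) /\<^sub>R (1 + q)) \<le> M"
      using \<open>q \<ge> 0\<close> by (simp only: norm_scaleR) (simp add: divide_inverse_commute)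
  qed blast
  have convY: "convergent (\<lambda>n. Y (r n) q)" if "q \<in> \<rat>" "q \<ge> 0" for q
  proof -
    have "q \<in> \<rat> \<inter> {0..}"
      using that by simp
    then obtain l where "(\<lambda>n. (Y (r n) q - x0) /\<^sub>R (1 + q)) \<longlonglongrightarrow> l"
      by (elim exE[OF conv])
    then have "(\<lambda>n. x0 + (1 + q) *\<^sub>R ((Y (r n) q - x0) /\<^sub>R (1 + q))) \<longlonglongrightarrow> x0 + (1 + q) *\<^sub>R l"
      by (intro tendsto_intros)
    then show ?thesis
      using that by (auto simp: convergent_def)
  qed
  have "convergent (\<lambda>n. Y (r n) t)" if "t \<ge> 0" for t
  proof -
    have "Cauchy (\<lambda>n. Y (r n) t)"
    proof (rule CauchyI)
      fix e :: real assume "e > 0"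
      \<comment> \<open>\<open>M + 1\<close> rather than \<open>M\<close>, which may be \<open>0\<close>\<close>
      define d where "d = e / (3 * (M + 1))"
      have "d > 0"
        using \<open>e > 0\<close> \<open>M \<ge> 0\<close> by (simp add: d_def)
      then obtain q where q: "q \<in> \<rat>" "t < q" "q < t + d"
        using Rats_dense_in_real[of t "t + d"] by auto
      have "M * (q - t) \<le> M * d"
        using q \<open>M \<ge> 0\<close> by (intro mult_left_mono) auto
      also have "\<dots> < e / 3"
        using \<open>e > 0\<close> \<open>M \<ge> 0\<close> by (simp add: d_def field_simps)
      finally have close: "norm (Y n q - Y n t) < e / 3" for n
        using Ylip[of t q n] q that by linarith
      have "Cauchy (\<lambda>n. Y (r n) q)"
        using convY[of q] q that by (simp add: convergent_Cauchy)
      then obtain N where N: "\<And>m n. m \<ge> N \<Longrightarrow> n \<ge> N \<Longrightarrow> norm (Y (r m) q - Y (r n) q) < e / 3"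
        using \<open>e > 0\<close> CauchyD[of "\<lambda>n. Y (r n) q" "e / 3"] by auto
      have "norm (Y (r m) t - Y (r n) t) < e" if "m \<ge> N" "n \<ge> N" for m n
      proof -
        have "Y (r m) t - Y (r n) t = (Y (r m) q - Y (r n) q) - (Y (r m) q - Y (r m) t)
            + (Y (r n) q - Y (r n) t)"
          by simp
        also have "norm \<dots> \<le> norm (Y (r m) q - Y (r n) q) + norm (Y (r m) q - Y (r m) t)
            + norm (Y (r n) q - Y (r n) t)"
          by (meson add_right_mono norm_triangle_ineq norm_triangle_ineq4 order_trans)
        finally show ?thesis
          using N[OF that] close[of "r m"] close[of "r n"] by linarith
      qed
      then show "\<exists>N. \<forall>m\<ge>N. \<forall>n\<ge>N. norm (Y (r m) t - Y (r n) t) < e"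
        by blast
    qed
    then show ?thesis
      by (rule Cauchy_convergent)
  qed
  define x where "x = (\<lambda>t. lim (\<lambda>n. Y (r n) t))"
  have Yx: "(\<lambda>n. Y (r n) t) \<longlonglongrightarrow> x t" if "t \<ge> 0" for t
    using \<open>\<And>t. t \<ge> 0 \<Longrightarrow> convergent (\<lambda>n. Y (r n) t)\<close>[OF that]
    by (simp add: x_def convergent_LIMSEQ_iff)
  have "h \<longlonglongrightarrow> 0"
    unfolding h_def by (rule LIMSEQ_inverse_real_of_nat)
  then have hr: "(\<lambda>n. M * h (r n)) \<longlonglongrightarrow> 0"
    using LIMSEQ_subseq_LIMSEQ[OF _ r] tendsto_mult_right_zero by (fastforce simp: o_def)
  have Px: "(\<lambda>n. P (r n) s) \<longlonglongrightarrow> x s" if "s \<ge> 0" for s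
  proof -
    have "(\<lambda>n. Y (r n) s - P (r n) s) \<longlonglongrightarrow> 0"
      by (rule Lim_null_comparison[OF _ hr]) (use YP that in auto)
    with Yx[OF that] show ?thesis
      using tendsto_diff by fastforce
  qed
  have eq: "x t = x0 + integral {0..t} (\<lambda>s. F (x s))" if "0 \<le> t" for t
  proof -
    have "(\<lambda>n. integral {0..t} (\<lambda>s. F (P (r n) s))) \<longlonglongrightarrow> integral {0..t} (\<lambda>s. F (x s))"
    proof (rule dominated_convergence(2))
      show "(\<lambda>s. M) integrable_on {0..t}"
        by (rule integrable_const_ivl)
      show "(\<lambda>n. F (P (r n) s)) \<longlonglongrightarrow> F (x s)" if "s \<in> {0..t}" for s
        using that by (intro continuous_on_tendsto_compose[OF cont] Px) auto
    qed (use int bound in auto)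
    then have "(\<lambda>n. Y (r n) t) \<longlonglongrightarrow> x0 + integral {0..t} (\<lambda>s. F (x s))"
      unfolding Y_def by (intro tendsto_intros)
    with Yx[OF that] show ?thesis
      using LIMSEQ_unique by blast
  qed
  have xlip: "norm (x t - x s) \<le> M * (t - s)" if "0 \<le> s" "s \<le> t" for s t
    by (rule tendsto_upperbound[OF tendsto_norm[OF tendsto_diff[OF Yx Yx]]])
      (use Ylip that in auto)
  have "M-lipschitz_on {0..} x"
  proof (rule lipschitz_onI)
    fix s t :: real assume "s \<in> {0..}" "t \<in> {0..}"
    then show "dist (x s) (x t) \<le> M * dist s t"
      using xlip[of s t] xlip[of t s] by (cases "s \<le> t") (auto simp: dist_norm norm_minus_commute)
  qed fact
  then have "continuous_on {0..} x"
    by (rule lipschitz_on_continuous_on)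
  then show thesis
    by (rule that) (rule eq)
qed

lemma integral_equation_imp_ode_solution:
  fixes F :: "'a::euclidean_space \<Rightarrow> 'a"
  assumes F: "continuous_on UNIV F" and x: "continuous_on {0..} x"
    and eq: "\<And>t. 0 \<le> t \<Longrightarrow> x t = x0 + integral {0..t} (\<lambda>s. F (x s))"
  shows "ode_solution F x0 x"
  unfolding ode_solution_def
proof (intro conjI allI impI)
  show "x 0 = x0"
    using eq[of 0] by simp
  fix t :: real assume t: "t \<ge> 0"
  have "continuous_on {0..t + 1} (\<lambda>s. F (x s))"
    by (rule continuous_on_compose2[OF F continuous_on_subset[OF x]]) auto
  then have "((\<lambda>u. x0 + integral {0..u} (\<lambda>s. F (x s))) has_vector_derivative F (x t))
      (at t within {0..t + 1})"
    using integral_has_vector_derivative[of 0 "t + 1" "\<lambda>s. F (x s)" t] t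
    by (auto intro!: derivative_eq_intros)
  then have "(x has_vector_derivative F (x t)) (at t within {0..t + 1})"
    by (rule has_vector_derivative_transform[rotated 2]) (use eq t in auto)
  moreover have "at t within {0..t + 1} = at t within {0..}"
    by (rule at_within_nhd[of _ "{..<t + 1}"]) auto
  ultimately show "(x has_vector_derivative F (x t)) (at t within {0..})"
    by simp
qed

section \<open>Controls and trajectories\<close>

text \<open>A telescoping argument: it reduces inequalities between increments over \<open>{a..b}\<close> to
  arbitrarily short steps, on which uniform continuity applies.\<close>
lemma increasing_of_short_steps:
  fixes G :: "real \<Rightarrow> real"
  assumes "d > 0" "a \<le> b"
    and step: "\<And>s t. a \<le> s \<Longrightarrow> s \<le> t \<Longrightarrow> t \<le> b \<Longrightarrow> t - s \<le> d \<Longrightarrow> G s \<le> G t"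
  shows "G a \<le> G b"
proof -
  have "G a \<le> G t" if "a \<le> t" "t \<le> b" "t - a \<le> real n * d" for n t
    using that
  proof (induction n arbitrary: t)
    case (Suc n)
    define s where "s = max a (t - d)"
    have "G a \<le> G s"
      using Suc \<open>d > 0\<close> by (intro Suc.IH) (auto simp: s_def algebra_simps max_def)
    also have "G s \<le> G t"
      using Suc.prems \<open>d > 0\<close> by (intro step) (auto simp: s_def)
    finally show ?case .
  qed auto
  moreover obtain n where "b - a \<le> real n * d"
    using reals_Archimedean3[OF \<open>d > 0\<close>] less_imp_le by metis
  ultimately show ?thesis
    using \<open>a \<le> b\<close> by blast
qed

lemma ess_bounded_imp_absolutely_integrable:
  fixes w :: "real \<Rightarrow> 'a::euclidean_space"
  assumes "w \<in> borel_measurable (lebesgue_on {a..b})"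
    and "AE t in lebesgue_on {a..b}. norm (w t) \<le> C"
  shows "w absolutely_integrable_on {a..b}"
proof -
  interpret finite_measure "lebesgue_on {a..b}"
    by (rule finite_measure_lebesgue_on) simp
  have "integrable (lebesgue_on {a..b}) w"
    using assms(2,1) by (rule integrable_const_bound)
  then show ?thesis
    by (simp add: integrable_restrict_space set_integrable_def)
qed

lemma locally_ess_bounded_measurable:
  assumes "locally_ess_bounded u"
  shows "u \<in> borel_measurable (lebesgue_on {0..T})"
  using assms unfolding locally_ess_bounded_def
  by (auto intro: measurable_restrict_mono)

lemma locally_ess_bounded_absolutely_integrable:
  assumes "locally_ess_bounded u" "T \<ge> 0"
  shows "u absolutely_integrable_on {0..T}"
proof -
  obtain C where "AE t in lebesgue_on {0..T}. norm (u t) \<le> C"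
    using assms unfolding locally_ess_bounded_def by blast
  with locally_ess_bounded_measurable[OF assms(1)] show ?thesis
    by (rule ess_bounded_imp_absolutely_integrable)
qed

lemma trajectory_continuous:
  assumes "locally_ess_bounded u" "T \<ge> 0"
  shows "continuous_on {0..T} (trajectory x0 u)"
proof -
  have "u integrable_on {0..T}"
    using locally_ess_bounded_absolutely_integrable[OF assms] set_lebesgue_integral_eq_integral(1)
    by blast
  then show ?thesis
    unfolding trajectory_def by (intro continuous_intros indefinite_integral_continuous_1)
qed

lemma trajectory_diff:
  assumes "locally_ess_bounded u" "0 \<le> s" "s \<le> t"
  shows "trajectory x0 u t - trajectory x0 u s = integral {s..t} u"
proof -
  have "u integrable_on {0..t}"
    using locally_ess_bounded_absolutely_integrable[of u t] assms set_lebesgue_integral_eq_integral(1)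
    by fastforce
  then have "integral {0..s} u + integral {s..t} u = integral {0..t} u"
    using assms by (intro Henstock_Kurzweil_Integration.integral_combine)
  then show ?thesis
    by (simp add: trajectory_def algebra_simps)
qed

lemma extended_integral_nonneg:
  assumes "\<And>t. g t \<ge> 0"
  shows "extended_integral M g = enn2ereal (\<integral>\<^sup>+ t. ennreal (g t) \<partial>M)"
proof -
  have "ennreal (- g t) = 0" for t
    using assms[of t] by (simp add: ennreal_neg)
  then show ?thesis
    by (simp add: extended_integral_def zero_ennreal.rep_eq)
qed

section \<open>The Bregman divergence as a Lyapunov function\<close>

locale bregman_control =
  f: legendre_function f + phi: legendre_function \<phi>
  for f \<phi> :: "'a::euclidean_space \<Rightarrow> real" +
  fixes ybar :: 'a
  assumes minimizer: "f ybar \<le> f y"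
    and coercive: "filterlim (\<lambda>x. bregman (conjugate \<phi>) x (grad \<phi> ybar)) at_top at_infinity"
begin

definition xbar :: 'a where "xbar = grad \<phi> ybar"

definition V :: "'a \<Rightarrow> real" where "V x = bregman (conjugate \<phi>) x xbar"

abbreviation "q \<equiv> running_cost f \<phi> ybar"

abbreviation "F \<equiv> closed_loop_field f \<phi>"

text \<open>The running cost of the feedback control; it is also the rate at which \<open>V\<close> decreases
  along the closed loop.\<close>
definition W :: "'a \<Rightarrow> real" where "W x = q x (F x)"

lemma grad_inv_xbar [simp]: "phi.grad_inv xbar = ybar"
  by (simp add: xbar_def)

lemma V_eq: "V x = conjugate \<phi> x - conjugate \<phi> xbar - ybar \<bullet> (x - xbar)"
  by (simp add: V_def bregman_def phi.grad_conjugate)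

lemma q_eq: "q x u = f (phi.grad_inv x) + conjugate f (- u) + u \<bullet> ybar"
  by (simp add: running_cost_def phi.grad_conjugate)

lemma F_eq: "F x = - grad f (phi.grad_inv x)"
  by (simp add: closed_loop_field_def phi.grad_conjugate)

lemma continuous_grad_inv: "continuous_on S h \<Longrightarrow> continuous_on S (\<lambda>x. phi.grad_inv (h x))"
  using continuous_on_compose2[OF phi.continuous_grad_inv] by blast

lemma continuous_F: "continuous_on S F"
  unfolding F_eq
  by (intro continuous_intros continuous_on_compose2[OF f.continuous_grad] continuous_grad_inv) auto

lemma continuous_V: "continuous_on S V"
  unfolding V_eq by (intro continuous_intros phi.continuous_conjugate)

lemma continuous_q: "continuous_on S (\<lambda>p. q (fst p) (snd p))"
  unfolding q_eq
  by (intro continuous_intros continuous_on_compose2[OF f.continuous]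
      continuous_on_compose2[OF f.continuous_conjugate] continuous_grad_inv) auto

lemma continuous_W: "continuous_on S W"
proof -
  have "continuous_on S (\<lambda>x. (x, F x))"
    by (intro continuous_intros continuous_F)
  from continuous_on_compose2[OF continuous_q[of UNIV] this] show ?thesis
    by (simp add: W_def)
qed

lemma V_tangent_le: "V x + (phi.grad_inv x - ybar) \<bullet> (y - x) \<le> V y"
  using phi.conjugate_tangent_le[of x y] by (simp add: V_eq inner_diff inner_commute)

lemma V_has_derivative_along:
  assumes "(x has_vector_derivative v) (at t within S)"
  shows "((\<lambda>t. V (x t)) has_real_derivative (phi.grad_inv (x t) - ybar) \<bullet> v) (at t within S)"
proof -
  have "(V has_derivative (\<lambda>h. h \<bullet> phi.grad_inv (x t) - ybar \<bullet> h)) (at (x t))"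
    unfolding V_eq using phi.gderiv_conjugate[of "x t", unfolded gderiv_def]
    by (auto intro!: derivative_eq_intros)
  moreover have "(x has_derivative (\<lambda>h. h *\<^sub>R v)) (at t within S)"
    using assms by (simp add: has_vector_derivative_def)
  ultimately have "((\<lambda>t. V (x t)) has_derivative
      (\<lambda>h. (h *\<^sub>R v) \<bullet> phi.grad_inv (x t) - ybar \<bullet> (h *\<^sub>R v))) (at t within S)"
    by (rule has_derivative_compose[rotated])
  moreover have "(\<lambda>h. (h *\<^sub>R v) \<bullet> phi.grad_inv (x t) - ybar \<bullet> (h *\<^sub>R v))
      = (*) ((phi.grad_inv (x t) - ybar) \<bullet> v)"
    by (auto simp: fun_eq_iff inner_diff inner_commute algebra_simps)
  ultimately show ?thesis
    by (simp add: has_field_derivative_def)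
qed

lemma V_xbar [simp]: "V xbar = 0"
  by (simp add: V_eq)

lemma grad_inv_eq_ybar_iff: "phi.grad_inv x = ybar \<longleftrightarrow> x = xbar"
  using phi.grad_grad_inv by (auto simp: xbar_def)

text \<open>\<open>V x\<close> is the Fenchel--Young gap of \<open>\<phi>\<close> at \<open>ybar\<close> and \<open>x\<close>, which is positive unless \<open>ybar\<close> is
  the maximizer \<open>grad_inv x\<close>.\<close>
lemma V_pos:
  assumes "x \<noteq> xbar" shows "V x > 0"
proof -
  have "x \<bullet> ybar < \<phi> ybar + conjugate \<phi> x"
    using assms grad_inv_eq_ybar_iff by (intro phi.fenchel_young_less) auto
  moreover have "conjugate \<phi> xbar = xbar \<bullet> ybar - \<phi> ybar"
    by (simp add: phi.conjugate_eq)
  ultimately show ?thesis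
    by (simp add: V_eq inner_diff_right inner_commute)
qed

lemma V_nonneg: "V x \<ge> 0"
  using V_pos[of x] by (cases "x = xbar") auto

lemma compact_sublevel: "compact {x. V x \<le> c}"
proof -
  obtain B where B: "\<And>x. norm x \<ge> B \<Longrightarrow> V x > c"
    using coercive unfolding filterlim_at_top_dense eventually_at_infinity V_def xbar_def by blast
  have "norm x \<le> B" if "V x \<le> c" for x
    using B[of x] that by linarith
  then have "bounded {x. V x \<le> c}"
    by (auto simp: bounded_iff)
  moreover have "closed {x. V x \<le> c}"
    by (intro closed_Collect_le continuous_V continuous_intros)
  ultimately show ?thesis
    by (simp add: compact_eq_bounded_closed)
qed

text \<open>The Fenchel--Young inequality for \<open>f\<close> at the pair \<open>grad_inv x\<close>, \<open>- u\<close>.  The left-hand side is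
  \<open>- \<langle>grad V x, u\<rangle>\<close>, so the running cost pays for every decrease of \<open>V\<close>.\<close>
lemma q_ge: "- (u \<bullet> (phi.grad_inv x - ybar)) \<le> q x u"
  using f.fenchel_young[of "- u" "phi.grad_inv x"] by (simp add: q_eq inner_diff_right)

text \<open>Testing the conjugate of \<open>f\<close> at \<open>ybar\<close> instead gives \<open>q x u \<ge> f (grad_inv x) - f ybar\<close>.\<close>
lemma q_nonneg: "q x u \<ge> 0"
  using f.fenchel_young[of "- u" ybar] minimizer[of "phi.grad_inv x"] by (simp add: q_eq)

lemma grad_f_ybar: "grad f ybar = 0"
proof -
  have "(\<lambda>h. h \<bullet> grad f ybar) = (\<lambda>h. 0)"
    using f.gderiv[of ybar]
    by (intro differential_zero_maxmin[of ybar UNIV f]) (auto simp: minimizer gderiv_def)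
  then show ?thesis
    by (metis inner_eq_zero_iff)
qed

lemma F_xbar: "F xbar = 0"
  by (simp add: F_eq grad_f_ybar)

text \<open>For the feedback control the Fenchel--Young inequality in \<open>q_ge\<close> is an equality, because
  \<open>- F x\<close> is the gradient of \<open>f\<close> at \<open>grad_inv x\<close>.\<close>
lemma W_eq: "W x = - (F x \<bullet> (phi.grad_inv x - ybar))"
  by (simp add: W_def q_eq F_eq f.conjugate_grad inner_diff_right)

text \<open>\<open>W x = \<langle>grad f y, y - ybar\<rangle>\<close> with \<open>y = grad_inv x\<close>, and the strict tangent inequality at \<open>y\<close>
  makes this larger than \<open>f y - f ybar\<close>.\<close>
lemma W_pos:
  assumes "x \<noteq> xbar" shows "W x > 0"
proof -
  have "f (phi.grad_inv x) + grad f (phi.grad_inv x) \<bullet> (ybar - phi.grad_inv x) < f ybar"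
    using assms grad_inv_eq_ybar_iff by (intro f.tangent_less) auto
  with minimizer[of "phi.grad_inv x"] show ?thesis
    by (simp add: W_eq F_eq inner_diff_right)
qed

lemma W_nonneg: "W x \<ge> 0"
  by (simp add: W_def q_nonneg)

text \<open>Outside any ball around \<open>xbar\<close> the function \<open>V\<close> is bounded away from \<open>0\<close>, by compactness of
  its sublevel sets.\<close>
lemma V_tendsto_zero_imp_tendsto_xbar:
  assumes "((\<lambda>t. V (x t)) \<longlongrightarrow> 0) G"
  shows "(x \<longlongrightarrow> xbar) G"
proof (rule tendstoI)
  fix d :: real assume "d > 0"
  define K where "K = {z. V z \<le> 1} \<inter> - ball xbar d"
  have "compact K"
    unfolding K_def by (intro compact_Int_closed compact_sublevel) auto
  obtain e where "e > 0" and e: "\<And>z. z \<in> K \<Longrightarrow> e \<le> V z"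
  proof (cases "K = {}")
    case False
    then obtain z where z: "z \<in> K" "\<And>w. w \<in> K \<Longrightarrow> V z \<le> V w"
      using continuous_attains_inf[OF \<open>compact K\<close> _ continuous_V] by blast
    then have "z \<noteq> xbar"
      using \<open>d > 0\<close> by (auto simp: K_def)
    with z that V_pos show ?thesis by blast
  qed (use that[of 1] in auto)
  have "\<forall>\<^sub>F t in G. V (x t) < min 1 e"
    using assms \<open>e > 0\<close> by (intro order_tendstoD) auto
  then show "\<forall>\<^sub>F t in G. dist (x t) xbar < d"
  proof (rule eventually_mono)
    fix t assume "V (x t) < min 1 e"
    then have "x t \<notin> K"
      using e by fastforce
    with \<open>V (x t) < min 1 e\<close> show "dist (x t) xbar < d"
      by (auto simp: K_def dist_commute)
  qed
qed

section \<open>The lower bound for an arbitrary control\<close>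

text \<open>Up to time \<open>T\<close> almost every pair of a state and a control value lies in a compact set, on
  which the continuous function \<open>q\<close> is bounded.\<close>
lemma cost_absolutely_integrable:
  assumes u: "locally_ess_bounded u" and "T \<ge> 0"
  shows "(\<lambda>s. q (trajectory x0 u s) (u s)) absolutely_integrable_on {0..T}"
proof -
  let ?x = "trajectory x0 u"
  have x: "continuous_on {0..T} ?x"
    using assms by (rule trajectory_continuous)
  obtain C where C: "AE t in lebesgue_on {0..T}. norm (u t) \<le> C"
    using assms unfolding locally_ess_bounded_def by blast
  have "compact ((\<lambda>p. q (fst p) (snd p)) ` (?x ` {0..T} \<times> cball 0 C))"
    by (intro compact_continuous_image continuous_q compact_Times x compact_Icc compact_cball)
  then have "bounded ((\<lambda>p. q (fst p) (snd p)) ` (?x ` {0..T} \<times> cball 0 C))"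
    by (rule compact_imp_bounded)
  then obtain B where bnd: "\<forall>y \<in> (\<lambda>p. q (fst p) (snd p)) ` (?x ` {0..T} \<times> cball 0 C). norm y \<le> B"
    unfolding bounded_iff by (elim exE)
  have B: "norm (q (fst p) (snd p)) \<le> B" if "p \<in> ?x ` {0..T} \<times> cball 0 C" for p
    using bspec[OF bnd imageI[OF that]] .
  have "?x \<in> borel_measurable (lebesgue_on {0..T})"
    using x by (rule continuous_imp_measurable_on_sets_lebesgue) simp
  then have "(\<lambda>s. (?x s, u s)) \<in> borel_measurable (lebesgue_on {0..T})"
    using locally_ess_bounded_measurable[OF u] by (rule borel_measurable_Pair)
  then have "(\<lambda>s. q (fst (?x s, u s)) (snd (?x s, u s))) \<in> borel_measurable (lebesgue_on {0..T})"
    by (rule borel_measurable_continuous_on[OF continuous_q])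
  moreover have "AE s in lebesgue_on {0..T}. norm (q (?x s) (u s)) \<le> B"
    using C AE_space
  proof eventually_elim
    case (elim s)
    then show ?case
      using B[of "(?x s, u s)"] by simp
  qed
  ultimately show ?thesis
    using ess_bounded_imp_absolutely_integrable[of "\<lambda>s. q (?x s) (u s)" 0 T B] by simp
qed

text \<open>Formally this integrates \<open>q_ge\<close> along the trajectory, but \<open>u\<close> is only measurable, so
  \<open>V\<close> along the trajectory need not be differentiable everywhere.  Convexity replaces the chain rule: over
  a short step from \<open>s\<close> to \<open>t\<close> the decrease of \<open>V\<close> is at most
  \<open>- \<langle>grad V (x s), x t - x s\<rangle>\<close>, an integral of \<open>u\<close> against a frozen gradient.  Replacing
  the frozen gradient by the current one costs at most \<open>e * \<integral>|u|\<close> by uniform continuity;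
  the errors add up to \<open>e\<close> times the total integral of \<open>|u|\<close>, and \<open>e\<close> is arbitrary.\<close>
lemma dissipation_inequality:
  assumes u: "locally_ess_bounded u" and "T \<ge> 0"
  shows "V x0 - V (trajectory x0 u T) \<le> integral {0..T} (\<lambda>s. q (trajectory x0 u s) (u s))"
proof -
  let ?x = "trajectory x0 u"
  let ?q = "\<lambda>s. q (?x s) (u s)"
  have ua: "u absolutely_integrable_on {0..T}"
    using assms by (rule locally_ess_bounded_absolutely_integrable)
  have ui: "u integrable_on {0..T}" and ni: "(\<lambda>s. norm (u s)) integrable_on {0..T}"
    using ua by (auto simp: absolutely_integrable_on_def)
  have qi: "?q integrable_on {0..T}"
    using cost_absolutely_integrable[OF assms, of x0] set_lebesgue_integral_eq_integral(1) by blast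
  have x: "continuous_on {0..T} ?x"
    using assms by (rule trajectory_continuous)
  have "uniformly_continuous_on {0..T} (\<lambda>s. phi.grad_inv (?x s))"
    by (intro compact_uniformly_continuous continuous_grad_inv x compact_Icc)
  note unif = this[unfolded uniformly_continuous_on_def dist_norm, rule_format]
  have main: "V x0 - V (?x T) \<le> integral {0..T} ?q + e * integral {0..T} (\<lambda>s. norm (u s))"
    if "e > 0" for e
  proof -
    obtain d where "d > 0"
      and d: "\<And>r s. r \<in> {0..T} \<Longrightarrow> s \<in> {0..T} \<Longrightarrow> norm (r - s) < d
        \<Longrightarrow> norm (phi.grad_inv (?x r) - phi.grad_inv (?x s)) < e"
      using unif[OF \<open>e > 0\<close>] by blast
    define G where "G = (\<lambda>t. V (?x t) + integral {0..t} ?q + e * integral {0..t} (\<lambda>s. norm (u s)))"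
    have step: "G s \<le> G t" if st: "0 \<le> s" "s \<le> t" "t \<le> T" "t - s \<le> d / 2" for s t
    proof -
      let ?p = "phi.grad_inv (?x s) - ybar"
      have sub: "g integrable_on {s..t}" "g integrable_on {0..t}"
        if "g integrable_on {0..T}" for g :: "real \<Rightarrow> 'b::euclidean_space"
        using integrable_subinterval_real[OF that] st by auto
      have split: "integral {0..t} g = integral {0..s} g + integral {s..t} g"
        if "g integrable_on {0..T}" for g :: "real \<Rightarrow> real"
        using Henstock_Kurzweil_Integration.integral_combine[OF _ _ sub(2)[OF that], of s] st by simp
      have pi: "(\<lambda>r. ?p \<bullet> u r) integrable_on {s..t}"
        and p_int: "integral {s..t} (\<lambda>r. ?p \<bullet> u r) = ?p \<bullet> integral {s..t} u"
        using integrable_linear[OF sub(1)[OF ui] bounded_linear_inner_right, of ?p]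
          integral_linear[OF sub(1)[OF ui] bounded_linear_inner_right, of ?p] by (simp_all add: o_def)
      have ei: "(\<lambda>r. e * norm (u r)) integrable_on {s..t}"
        using integrable_cmul[OF sub(1)[OF ni], of e] by simp
      have "0 \<le> ?p \<bullet> u r + ?q r + e * norm (u r)" if "r \<in> {s..t}" for r
      proof -
        have "norm (phi.grad_inv (?x r) - phi.grad_inv (?x s)) \<le> e"
          using d[of r s] st that \<open>d > 0\<close> by fastforce
        then have "norm (u r) * norm (phi.grad_inv (?x r) - phi.grad_inv (?x s)) \<le> norm (u r) * e"
          by (intro mult_left_mono) auto
        then have "u r \<bullet> (phi.grad_inv (?x r) - phi.grad_inv (?x s)) \<le> norm (u r) * e"
          using norm_cauchy_schwarz order_trans by blast
        moreover have "- (u r \<bullet> (phi.grad_inv (?x r) - ybar)) \<le> ?q r"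
          by (rule q_ge)
        ultimately show ?thesis
          by (simp add: inner_diff inner_commute algebra_simps)
      qed
      then have "0 \<le> integral {s..t} (\<lambda>r. ?p \<bullet> u r + ?q r + e * norm (u r))"
        by (intro integral_nonneg integrable_add pi ei sub(1)[OF qi])
      also have "\<dots> = ?p \<bullet> integral {s..t} u + integral {s..t} ?q
          + e * integral {s..t} (\<lambda>r. norm (u r))"
        by (simp add: integral_add integrable_add pi ei sub(1)[OF qi] p_int)
      finally show ?thesis
        using V_tangent_le[of "?x s" "?x t"] trajectory_diff[OF u st(1,2), of x0]
        by (simp add: G_def split[OF qi] split[OF ni] algebra_simps)
    qed
    have "G 0 \<le> G T"
      by (rule increasing_of_short_steps[of "d / 2" 0 T])
        (simp_all only: step, use \<open>d > 0\<close> \<open>T \<ge> 0\<close> in simp_all)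
    then show ?thesis
      by (simp add: G_def trajectory_def)
  qed
  let ?A = "integral {0..T} (\<lambda>s. norm (u s))"
  have "((\<lambda>e. integral {0..T} ?q + e * ?A) \<longlongrightarrow> integral {0..T} ?q + 0 * ?A) (at_right 0)"
    by (intro tendsto_intros)
  moreover have "\<forall>\<^sub>F e in at_right 0. V x0 - V (?x T) \<le> integral {0..T} ?q + e * ?A"
    using main by (auto simp: eventually_at_right_field intro!: exI[of _ 1])
  ultimately show ?thesis
    using tendsto_lowerbound by fastforce
qed

lemma total_cost_eq:
  "total_cost f \<phi> ybar x0 u
    = enn2ereal (\<integral>\<^sup>+ t. ennreal (q (trajectory x0 u t) (u t)) \<partial>lebesgue_on {0..})"
  unfolding total_cost_def by (rule extended_integral_nonneg) (rule q_nonneg)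

text \<open>As the integrand is nonnegative, the total cost dominates the cost up to every time \<open>T\<close>,
  and \<open>V\<close> vanishes in the limit along a stabilizing trajectory.\<close>
lemma total_cost_ge:
  assumes "u \<in> stabilizing_controls xbar x0"
  shows "ereal (V x0) \<le> total_cost f \<phi> ybar x0 u"
proof -
  let ?x = "trajectory x0 u"
  let ?q = "\<lambda>s. q (?x s) (u s)"
  have u: "locally_ess_bounded u" and lim: "(?x \<longlongrightarrow> xbar) at_top"
    using assms by (auto simp: stabilizing_controls_def)
  have "ennreal (V x0 - V (?x T)) \<le> (\<integral>\<^sup>+ t. ennreal (?q t) \<partial>lebesgue_on {0..})" if "T \<ge> 0" for T
  proof -
    have "integrable (lebesgue_on {0..T}) ?q"
      using cost_absolutely_integrable[OF u that, of x0]
      by (simp add: integrable_restrict_space set_integrable_def)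
    then have "ennreal (integral {0..T} ?q) = (\<integral>\<^sup>+ t. ennreal (?q t) \<partial>lebesgue_on {0..T})"
      by (simp add: nn_integral_eq_integral lebesgue_integral_eq_integral q_nonneg)
    also have "\<dots> \<le> (\<integral>\<^sup>+ t. ennreal (?q t) \<partial>lebesgue_on {0..})"
      by (auto simp: nn_integral_restrict_space intro!: nn_integral_mono split: split_indicator)
    finally show ?thesis
      using dissipation_inequality[OF u that, of x0] ennreal_leI order_trans by blast
  qed
  then have "\<forall>\<^sub>F T in at_top. ennreal (V x0 - V (?x T)) \<le> (\<integral>\<^sup>+ t. ennreal (?q t) \<partial>lebesgue_on {0..})"
    using eventually_ge_at_top[of "0::real"] by (rule eventually_mono[rotated])
  moreover have "((\<lambda>T. V (?x T)) \<longlongrightarrow> V xbar) at_top"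
    by (rule continuous_on_tendsto_compose[OF continuous_V[of UNIV] lim]) auto
  then have "((\<lambda>T. ennreal (V x0 - V (?x T))) \<longlongrightarrow> ennreal (V x0 - V xbar)) at_top"
    by (intro tendsto_intros)
  ultimately have "ennreal (V x0) \<le> (\<integral>\<^sup>+ t. ennreal (?q t) \<partial>lebesgue_on {0..})"
    using tendsto_upperbound[of _ "ennreal (V x0)"] by fastforce
  then have "enn2ereal (ennreal (V x0)) \<le> enn2ereal (\<integral>\<^sup>+ t. ennreal (?q t) \<partial>lebesgue_on {0..})"
    by (simp add: less_eq_ennreal.rep_eq)
  then show ?thesis
    by (simp add: total_cost_eq enn2ereal_ennreal V_nonneg)
qed

section \<open>The closed loop\<close>

text \<open>Stated for an arbitrary field \<open>H\<close>, since it is needed both for the closed loop and for its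
  truncation in the existence proof.\<close>
lemma mean_value_along_solution:
  assumes "ode_solution H \<xi> x" "0 \<le> s" "s < t"
  obtains r where "s < r" "r < t"
    and "V (x t) - V (x s) = (t - s) * ((phi.grad_inv (x r) - ybar) \<bullet> H (x r))"
proof -
  have d: "((\<lambda>t. V (x t)) has_real_derivative (phi.grad_inv (x r) - ybar) \<bullet> H (x r)) (at r within {0..})"
    if "r \<ge> 0" for r
    using assms that unfolding ode_solution_def by (intro V_has_derivative_along) auto
  have "continuous_on {0..} (\<lambda>t. V (x t))"
    by (rule DERIV_continuous_on) (use d in auto)
  then have "continuous_on {s..t} (\<lambda>t. V (x t))"
    by (rule continuous_on_subset) (use assms in auto)
  moreover have "((\<lambda>t. V (x t)) has_derivative (*) ((phi.grad_inv (x r) - ybar) \<bullet> H (x r))) (at r)"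
    if "s < r" "r < t" for r
  proof -
    have "at r within {0..} = at r"
      using that assms by (intro at_within_interior) auto
    with d[of r] that assms show ?thesis
      by (simp add: has_field_derivative_def)
  qed
  ultimately obtain r where "r \<in> {s<..<t}"
      "V (x t) - V (x s) = ((phi.grad_inv (x r) - ybar) \<bullet> H (x r)) * (t - s)"
    using mvt[of s t "\<lambda>t. V (x t)" "\<lambda>r. (*) ((phi.grad_inv (x r) - ybar) \<bullet> H (x r))"] assms
    by (metis greaterThanLessThan_iff)
  then show ?thesis
    using that[of r] by (simp add: mult.commute)
qed

lemma ode_solution_continuous: "ode_solution H \<xi> x \<Longrightarrow> continuous_on {0..} x"
  unfolding ode_solution_def
  by (metis atLeast_iff continuous_on_eq_continuous_within has_vector_derivative_continuous)

lemma closed_loop_mean_value: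
  assumes "ode_solution F \<xi> x" "0 \<le> s" "s < t"
  obtains r where "s < r" "r < t" "V (x t) = V (x s) - (t - s) * W (x r)"
proof -
  obtain r where r: "s < r" "r < t"
    and "V (x t) - V (x s) = (t - s) * ((phi.grad_inv (x r) - ybar) \<bullet> F (x r))"
    by (rule mean_value_along_solution[OF assms])
  then have "V (x t) = V (x s) - (t - s) * W (x r)"
    by (simp add: W_eq inner_commute)
  with r show thesis by (rule that)
qed

lemma V_nonincreasing:
  assumes "ode_solution F \<xi> x" "0 \<le> s" "s \<le> t"
  shows "V (x t) \<le> V (x s)"
proof (cases "s = t")
  case False
  then obtain r where "V (x t) = V (x s) - (t - s) * W (x r)"
    using closed_loop_mean_value[OF assms(1,2)] assms(3) by (metis order_le_less)
  with W_nonneg[of "x r"] assms show ?thesis by simp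
qed simp

text \<open>The mean value theorem gives a decay rate \<open>W (x r)\<close> that can vanish only if the solution has
  already reached \<open>xbar\<close> at time \<open>r\<close>, and then \<open>V\<close> has dropped to \<open>0\<close>.\<close>
lemma V_strict_decrease:
  assumes sol: "ode_solution F \<xi> x" and "\<xi> \<noteq> xbar" "0 < t"
  shows "V (x t) < V \<xi>"
proof -
  have x0: "x 0 = \<xi>"
    using sol by (simp add: ode_solution_def)
  obtain r where r: "0 < r" "r < t" "V (x t) = V \<xi> - t * W (x r)"
    using closed_loop_mean_value[OF sol, of 0 t] assms x0 by auto
  show ?thesis
  proof (cases "x r = xbar")
    case True
    then have "V (x t) \<le> 0"
      using V_nonincreasing[OF sol, of r t] r by simp
    with V_pos[OF \<open>\<xi> \<noteq> xbar\<close>] show ?thesis by simp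
  next
    case False
    with r W_pos \<open>0 < t\<close> show ?thesis by simp
  qed
qed

text \<open>A bounded field \<open>H\<close> is obtained from the closed-loop field by composing it with the
  nearest-point projection onto a ball that contains the sublevel set of level \<open>V x0 + 1\<close>.  At a
  first time when \<open>V\<close> reaches that level, the solution would have followed the true field so
  far, along which \<open>V\<close> cannot increase above \<open>V x0\<close>.  Hence the truncation is never active.\<close>
lemma closed_loop_has_solution: "\<exists>x. ode_solution F x0 x"
proof -
  obtain R where R: "\<And>z. V z \<le> V x0 + 1 \<Longrightarrow> norm z \<le> R"
    using compact_imp_bounded[OF compact_sublevel] unfolding bounded_iff by blast
  have "R \<ge> 0"
    using order_trans[OF norm_ge_zero R[of x0]] by simp
  define H where "H = (\<lambda>z. F (closest_point (cball 0 R) z))"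
  have HF: "H z = F z" if "V z \<le> V x0 + 1" for z
    using R[OF that] by (simp add: H_def closest_point_self)
  have contH: "continuous_on UNIV H"
    unfolding H_def using \<open>R \<ge> 0\<close>
    by (intro continuous_on_compose2[OF continuous_F[of UNIV]] continuous_on_closest_point) auto
  have "bounded (F ` cball 0 R)"
    by (intro compact_imp_bounded compact_continuous_image continuous_F compact_cball)
  then obtain M where "\<forall>y \<in> F ` cball 0 R. norm y \<le> M"
    unfolding bounded_iff by (elim exE)
  then have M: "norm (F z) \<le> M" if "z \<in> cball 0 R" for z
    using that by blast
  have "norm (H z) \<le> M" for z
    unfolding H_def using \<open>R \<ge> 0\<close> by (intro M closest_point_in_set) auto
  then obtain x where x: "continuous_on {0::real..} x"
    and eq: "\<And>t. 0 \<le> t \<Longrightarrow> x t = x0 + integral {0..t} (\<lambda>s. H (x s))"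
    by (rule peano_integral_equation[OF contH, of M x0]) blast
  have sol: "ode_solution H x0 x"
    using contH x eq by (rule integral_equation_imp_ode_solution)
  then have x0: "x 0 = x0"
    by (simp add: ode_solution_def)
  have "V (x t) < V x0 + 1" if "t \<ge> 0" for t
  proof (rule ccontr)
    assume exits: "\<not> V (x t) < V x0 + 1"
    define S where "S = {s \<in> {0..t}. V x0 + 1 \<le> V (x s)}"
    have "continuous_on {0..t} (\<lambda>s. V (x s))"
      by (rule continuous_on_compose2[OF continuous_V[of UNIV] continuous_on_subset[OF x]]) auto
    then have "closed S"
      unfolding S_def by (intro continuous_on_closed_Collect_le continuous_intros) auto
    then have "compact S"
      by (auto simp: S_def compact_eq_bounded_closed intro: bounded_subset[of "{0..t}"])
    moreover have "t \<in> S"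
      using exits that by (simp add: S_def)
    ultimately obtain s where s: "s \<in> S" and first: "\<And>r. r \<in> S \<Longrightarrow> s \<le> r"
      using compact_attains_inf[of S] by blast
    have "s > 0"
      using s x0 by (cases "s = 0") (auto simp: S_def)
    then obtain r where r: "0 < r" "r < s"
      "V (x s) - V (x 0) = (s - 0) * ((phi.grad_inv (x r) - ybar) \<bullet> H (x r))"
      using mean_value_along_solution[OF sol, of 0 s] by auto
    have "r \<notin> S"
      using first[of r] r by auto
    then have "V (x r) \<le> V x0 + 1"
      using r s by (auto simp: S_def)
    then have "(phi.grad_inv (x r) - ybar) \<bullet> H (x r) \<le> 0"
      using W_nonneg[of "x r"] by (simp add: HF W_eq inner_commute)
    with r \<open>s > 0\<close> have "V (x s) \<le> V x0"
      using mult_nonneg_nonpos[of s "(phi.grad_inv (x r) - ybar) \<bullet> H (x r)"] by (simp add: x0)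
    with s show False
      by (simp add: S_def)
  qed
  then have "H (x t) = F (x t)" if "t \<ge> 0" for t
    using HF[of "x t"] that by (simp add: less_imp_le)
  with sol have "ode_solution F x0 x"
    by (simp add: ode_solution_def)
  then show ?thesis by blast
qed

text \<open>If \<open>V\<close> stayed above \<open>e\<close>, the solution would remain in the compact shell between two levels
  of \<open>V\<close>, where \<open>W\<close> has a positive minimum; \<open>V\<close> would then decrease linearly and become
  negative.\<close>
lemma V_tendsto_zero_along_solution:
  assumes sol: "ode_solution F x0 x"
  shows "((\<lambda>t. V (x t)) \<longlongrightarrow> 0) at_top"
proof (rule tendstoI)
  fix e :: real assume "e > 0"
  have x0: "x 0 = x0"
    using sol by (simp add: ode_solution_def)
  have "\<exists>t\<ge>0. V (x t) < e"
  proof (rule ccontr)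
    assume "\<not> ?thesis"
    then have ge: "V (x t) \<ge> e" if "t \<ge> 0" for t
      using that by force
    define K where "K = {z. V z \<le> V x0} \<inter> {z. e \<le> V z}"
    have "compact K"
      unfolding K_def
      by (intro compact_Int_closed compact_sublevel closed_Collect_le continuous_V continuous_intros)
    have inK: "x t \<in> K" if "t \<ge> 0" for t
      using ge[OF that] V_nonincreasing[OF sol, of 0 t] that by (simp add: K_def x0)
    then obtain z where z: "z \<in> K" "\<And>w. w \<in> K \<Longrightarrow> W z \<le> W w"
      using continuous_attains_inf[OF \<open>compact K\<close> _ continuous_W] by blast
    have "z \<noteq> xbar"
      using z \<open>e > 0\<close> by (auto simp: K_def)
    then have "W z > 0"
      by (rule W_pos)
    \<comment> \<open>by this time linear decrease at rate \<open>W z\<close> would have exhausted \<open>V x0\<close>\<close>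
    define t where "t = V x0 / W z + 1"
    have "t > 0"
      using V_nonneg[of x0] \<open>W z > 0\<close> by (simp add: t_def add_nonneg_pos)
    then obtain r where r: "0 < r" "V (x t) = V x0 - t * W (x r)"
      using closed_loop_mean_value[OF sol, of 0 t] x0 by auto
    have "t * W z \<le> t * W (x r)"
      using z(2) inK r \<open>t > 0\<close> by (intro mult_left_mono) auto
    moreover have "t * W z = V x0 + W z"
      using \<open>W z > 0\<close> by (simp add: t_def field_simps)
    ultimately show False
      using r V_nonneg[of "x t"] \<open>W z > 0\<close> by linarith
  qed
  then obtain t0 where "t0 \<ge> 0" "V (x t0) < e" by blast
  then have "dist (V (x t)) 0 < e" if "t \<ge> t0" for t
    using V_nonincreasing[OF sol, of t0 t] V_nonneg[of "x t"] that by simp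
  then show "\<forall>\<^sub>F t in at_top. dist (V (x t)) 0 < e"
    using eventually_ge_at_top[of t0] by (rule eventually_mono[rotated])
qed

lemma trajectory_closed_loop:
  assumes sol: "ode_solution F x0 x" and u: "\<And>t. 0 \<le> t \<Longrightarrow> u t = F (x t)" and "t \<ge> 0"
  shows "trajectory x0 u t = x t"
proof -
  have "(u has_integral x t - x 0) {0..t}"
    using \<open>t \<ge> 0\<close>
  proof (rule fundamental_theorem_of_calculus)
    fix s assume "s \<in> {0..t}"
    then show "(x has_vector_derivative u s) (at s within {0..t})"
      using sol u unfolding ode_solution_def
      by (auto intro: has_vector_derivative_within_subset[of _ _ _ "{0..}"])
  qed
  then show ?thesis
    using sol by (simp add: trajectory_def integral_unique ode_solution_def)
qed

lemma closed_loop_control_stabilizing: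
  assumes sol: "ode_solution F x0 x" and u: "\<And>t. 0 \<le> t \<Longrightarrow> u t = F (x t)"
  shows "u \<in> stabilizing_controls xbar x0"
proof -
  have "continuous_on {0..} (\<lambda>t. F (x t))"
    using continuous_on_compose2[OF continuous_F[of UNIV] ode_solution_continuous[OF sol]] by simp
  then have cont: "continuous_on {0..} u"
    using u by (subst continuous_on_cong[OF refl]) auto
  have "\<exists>C. AE t in lebesgue_on {0..T}. norm (u t) \<le> C" for T
  proof -
    have "bounded (u ` {0..T})"
      by (intro compact_imp_bounded compact_continuous_image continuous_on_subset[OF cont]) auto
    then obtain C where "\<forall>t \<in> {0..T}. norm (u t) \<le> C"
      unfolding bounded_iff by auto
    then have "AE t in lebesgue_on {0..T}. norm (u t) \<le> C"
      by (intro AE_I2) auto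
    then show ?thesis ..
  qed
  then have "locally_ess_bounded u"
    unfolding locally_ess_bounded_def
    using continuous_imp_measurable_on_sets_lebesgue[OF cont] by auto
  moreover have "(x \<longlongrightarrow> xbar) at_top"
    by (rule V_tendsto_zero_imp_tendsto_xbar[OF V_tendsto_zero_along_solution[OF sol]])
  then have "(trajectory x0 u \<longlongrightarrow> xbar) at_top"
  proof (rule Lim_transform_eventually)
    show "\<forall>\<^sub>F t in at_top. x t = trajectory x0 u t"
      using eventually_ge_at_top[of "0::real"]
      by eventually_elim (simp add: trajectory_closed_loop[OF sol u])
  qed
  ultimately show ?thesis
    by (simp add: stabilizing_controls_def)
qed

text \<open>The decay rate \<open>w\<close> is the derivative of \<open>- V\<close> along the solution.  It is extended to negative
  times by its value at \<open>0\<close>, and its primitive starts at \<open>-1\<close>, so that the primitive is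
  differentiable from both sides at \<open>0\<close>.\<close>
lemma closed_loop_total_cost:
  assumes sol: "ode_solution F x0 x" and u: "\<And>t. 0 \<le> t \<Longrightarrow> u t = F (x t)"
  shows "total_cost f \<phi> ybar x0 u = ereal (V x0)"
proof -
  define w where "w = (\<lambda>t. W (x (max 0 t)))"
  define A where "A = (\<lambda>t. integral {-1..t} w)"
  have "continuous_on UNIV (\<lambda>t. x (max 0 t))"
    by (rule continuous_on_compose2[OF ode_solution_continuous[OF sol]]) (auto intro!: continuous_intros)
  then have cont: "continuous_on S w" for S
    unfolding w_def
    using continuous_on_compose2[OF continuous_W[of UNIV]] continuous_on_subset by (metis subset_UNIV)
  have A: "DERIV A t :> w t" if "t \<ge> 0" for t
  proof -
    have "(A has_real_derivative w t) (at t within {-1..t + 1})"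
      unfolding A_def using that by (intro integral_has_real_derivative cont) auto
    moreover have "at t within {-1..t + 1} = at t"
      using that by (intro at_within_interior) auto
    ultimately show ?thesis by simp
  qed
  have "((\<lambda>t. V (x t)) has_vector_derivative - w t) (at t within {0..})" if "t \<ge> 0" for t
    using V_has_derivative_along[of x "F (x t)" t "{0..}"] sol that
    by (simp add: ode_solution_def w_def W_eq inner_commute has_real_derivative_iff_has_vector_derivative)
  then have V_int: "((\<lambda>t. - w t) has_integral V (x t) - V (x 0)) {0..t}" if "t \<ge> 0" for t
    using that by (intro fundamental_theorem_of_calculus)
      (auto intro: has_vector_derivative_within_subset[of _ _ _ "{0..}"])
  have A_eq: "A t = A 0 + (V x0 - V (x t))" if "t \<ge> 0" for t
  proof -
    have "integral {0..t} w = V x0 - V (x t)"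
      using integral_unique[OF has_integral_neg[OF V_int[OF that]]] sol
      by (simp add: ode_solution_def)
    moreover have "A t = A 0 + integral {0..t} w"
      unfolding A_def using that
      by (intro Henstock_Kurzweil_Integration.integral_combine[symmetric] integrable_continuous_real cont) auto
    ultimately show ?thesis by simp
  qed
  have "((\<lambda>t. A 0 + (V x0 - V (x t))) \<longlongrightarrow> A 0 + (V x0 - 0)) at_top"
    by (intro tendsto_intros V_tendsto_zero_along_solution[OF sol])
  then have "((\<lambda>t. A 0 + (V x0 - V (x t))) \<longlongrightarrow> A 0 + V x0) at_top"
    by simp
  then have lim: "(A \<longlongrightarrow> A 0 + V x0) at_top"
  proof (rule Lim_transform_eventually)
    show "\<forall>\<^sub>F t in at_top. A 0 + (V x0 - V (x t)) = A t"
      using eventually_ge_at_top[of "0::real"] by eventually_elim (rule A_eq[symmetric])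
  qed
  have "(\<integral>\<^sup>+ t. ennreal (q (trajectory x0 u t) (u t)) \<partial>lebesgue_on {0..})
      = (\<integral>\<^sup>+ t. ennreal (w t) * indicator {0..} t \<partial>lborel)"
  proof -
    have "(\<integral>\<^sup>+ t. ennreal (q (trajectory x0 u t) (u t)) \<partial>lebesgue_on {0..})
        = (\<integral>\<^sup>+ t. ennreal (w t) \<partial>lebesgue_on {0..})"
      using trajectory_closed_loop[OF sol, of u] u
      by (intro nn_integral_cong) (simp add: w_def W_def)
    also have "\<dots> = (\<integral>\<^sup>+ t. ennreal (w t) * indicator {0..} t \<partial>lebesgue)"
      by (intro nn_integral_restrict_space) simp
    finally show ?thesis
      by (simp only: nn_integral_completion)
  qed
  also have "\<dots> = ennreal (A 0 + V x0 - A 0)"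
    using cont W_nonneg
    by (intro nn_integral_FTC_atLeast A lim borel_measurable_continuous_onI) (auto simp: w_def)
  finally show ?thesis
    by (simp add: total_cost_eq enn2ereal_ennreal V_nonneg)
qed

end

section \<open>Optimality of the closed loop\<close>

theorem theorem1:
  fixes f \<phi> :: "real ^ 'n \<Rightarrow> real"
    and ybar xbar :: "real ^ 'n"
    and V :: "real ^ 'n \<Rightarrow> real"
  assumes f_C1: "C1_fun f"
    and f_convex: "strictly_convex f"
    and f_legendre: "legendre_type f"
    and f_min: "\<forall>z. (\<forall>y. f z \<le> f y) \<longleftrightarrow> z = ybar"
    and phi_C2: "C2_fun \<phi>"
    and phi_convex: "strictly_convex \<phi>"
    and phi_legendre: "legendre_type \<phi>"
    and bregman_coercive:
      "\<forall>x'. filterlim (\<lambda>x. bregman (conjugate \<phi>) x x') at_top at_infinity"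
    and xbar: "xbar = grad \<phi> ybar"
    and V: "\<forall>x. V x = bregman (conjugate \<phi>) x xbar"
  shows
    "(\<forall>x0. \<forall>u \<in> stabilizing_controls xbar x0.
        (\<forall>t\<ge>0.
           (\<lambda>s. running_cost f \<phi> ybar (trajectory x0 u s) (u s)) absolutely_integrable_on {0..t} \<and>
           integral {0..t} (\<lambda>s. running_cost f \<phi> ybar (trajectory x0 u s) (u s))
             \<ge> V x0 - V (trajectory x0 u t)) \<and>
        total_cost f \<phi> ybar x0 u \<ge> ereal (V x0)) \<and>
     (\<forall>x0.
        (\<exists>x. ode_solution (closed_loop_field f \<phi>) x0 x) \<and>
        (\<forall>x u. ode_solution (closed_loop_field f \<phi>) x0 x \<longrightarrow>
           (\<forall>t\<ge>0. u t = - grad f (grad (conjugate \<phi>) (x t))) \<longrightarrow>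
             u \<in> stabilizing_controls xbar x0 \<and>
             (\<forall>v \<in> stabilizing_controls xbar x0.
                total_cost f \<phi> ybar x0 u \<le> total_cost f \<phi> ybar x0 v) \<and>
             total_cost f \<phi> ybar x0 u = ereal (V x0))) \<and>
     global_lyapunov (closed_loop_field f \<phi>) xbar V"
proof -
  interpret c: bregman_control f \<phi> ybar
  proof
    show "f ybar \<le> f y" for y
      using f_min by blast
  qed (use assms in \<open>auto simp: bregman_coercive C2_fun_def\<close>)
  have xb: "xbar = c.xbar"
    by (simp add: xbar c.xbar_def)
  have Vc: "V = c.V"
    using V by (auto simp: c.V_def xb)
  have part1: "(\<lambda>s. running_cost f \<phi> ybar (trajectory x0 u s) (u s)) absolutely_integrable_on {0..t}"
      "integral {0..t} (\<lambda>s. running_cost f \<phi> ybar (trajectory x0 u s) (u s))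
             \<ge> V x0 - V (trajectory x0 u t)"
    if "u \<in> stabilizing_controls xbar x0" "t \<ge> 0" for x0 u t
  proof -
    have "locally_ess_bounded u"
      using that(1) by (simp add: stabilizing_controls_def)
    then show "(\<lambda>s. running_cost f \<phi> ybar (trajectory x0 u s) (u s)) absolutely_integrable_on {0..t}"
      "integral {0..t} (\<lambda>s. running_cost f \<phi> ybar (trajectory x0 u s) (u s))
             \<ge> V x0 - V (trajectory x0 u t)"
      unfolding Vc
      using c.cost_absolutely_integrable c.dissipation_inequality that(2) by simp_all
  qed
  have lower: "total_cost f \<phi> ybar x0 u \<ge> ereal (V x0)" if "u \<in> stabilizing_controls xbar x0" for x0 u
    using c.total_cost_ge that by (simp add: Vc xb)
  have closed_loop: "u \<in> stabilizing_controls xbar x0" "total_cost f \<phi> ybar x0 u = ereal (V x0)"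
    if "ode_solution (closed_loop_field f \<phi>) x0 x" "\<forall>t\<ge>0. u t = - grad f (grad (conjugate \<phi>) (x t))"
    for x0 x u
  proof -
    have u: "u t = closed_loop_field f \<phi> (x t)" if "t \<ge> 0" for t
      using \<open>\<forall>t\<ge>0. u t = - grad f (grad (conjugate \<phi>) (x t))\<close> that
      by (simp add: closed_loop_field_def)
    show "u \<in> stabilizing_controls xbar x0"
      using c.closed_loop_control_stabilizing[OF that(1) u] by (simp add: xb)
    show "total_cost f \<phi> ybar x0 u = ereal (V x0)"
      using c.closed_loop_total_cost[OF that(1) u] by (simp add: Vc)
  qed
  have lyapunov: "global_lyapunov (closed_loop_field f \<phi>) xbar V"
    unfolding global_lyapunov_def xb Vc
  proof (intro conjI allI impI)
    show "\<exists>\<sigma>>0. \<forall>x. ode_solution (closed_loop_field f \<phi>) \<xi> x \<longrightarrow>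
        (\<forall>t\<in>{0..\<sigma>}. c.V (x t) \<le> c.V \<xi>) \<and> c.V (x \<sigma>) < c.V \<xi>" if "\<xi> \<noteq> c.xbar" for \<xi>
      \<comment> \<open>at every positive time \<open>V\<close> is strictly below its initial value, so any \<open>\<sigma>\<close> serves\<close>
    proof (intro exI[of _ "1::real"] conjI allI impI ballI)
      fix x and t :: real
      assume sol: "ode_solution (closed_loop_field f \<phi>) \<xi> x"
      show "c.V (x 1) < c.V \<xi>"
        using c.V_strict_decrease[OF sol that] by simp
      show "c.V (x t) \<le> c.V \<xi>" if "t \<in> {0..1}"
        using c.V_nonincreasing[OF sol, of 0 t] sol that by (simp add: ode_solution_def)
    qed simp
  qed (simp_all add: c.F_xbar c.continuous_V c.V_pos c.compact_sublevel c.closed_loop_has_solution)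
  show ?thesis
  proof (intro conjI allI ballI impI)
    fix x0 x u v
    assume "ode_solution (closed_loop_field f \<phi>) x0 x"
      "\<forall>t\<ge>0. u t = - grad f (grad (conjugate \<phi>) (x t))"
    note closed_loop = closed_loop[OF this]
    show "u \<in> stabilizing_controls xbar x0" "total_cost f \<phi> ybar x0 u = ereal (V x0)"
      by (fact closed_loop)+
    show "total_cost f \<phi> ybar x0 u \<le> total_cost f \<phi> ybar x0 v"
      if "v \<in> stabilizing_controls xbar x0"
      using lower[OF that] closed_loop(2) by simp
  qed (simp_all add: part1 lower lyapunov c.closed_loop_has_solution)
qed

end
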